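(* Let $\Lambda=(V,E)$ be a finite tree with root $r$ and with unknown transition probabilities associated to its internal vertices. Let $\Lambda'$ be the $2$-spherical augmentation of $\Lambda$ and let $X$ be the augmented chain associated to $\Lambda'$. Let $\mathbb{P}_{\mathrm{in}}^r$ be the joint distribution of the first hitting time and the first hitting place of $X$ started at $r$ for vertices in the inner boundary layer $V_{\mathrm{in}}(\Lambda')$, and let $\mathbb{P}_{\mathrm{out}}^r$ be the joint distribution of the first hitting time and the first hitting place of $X$ started at $r$ for vertices in the outer boundary layer $V_{\mathrm{out}}(\Lambda')$. Then $\mathbb{P}_{\mathrm{in}}^r$ and $\mathbb{P}_{\mathrm{out}}^r$ completely determine the transition probabilities of $X$. (That is, if two augmented chains on the same $\Lambda'$ have the same $\mathbb{P}_{\mathrm{in}}^r$ and the same $\mathbb{P}_{\mathrm{out}}^r$, then they have the same transition probabilities.)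
   Context: A finite rooted tree $\Lambda=(V,E)$ is a finite connected graph without cycles with a distinguished vertex $r$ (the root). A vertex is terminal if it has exactly one neighbor; $V_{\mathrm{term}}(\Lambda)$ is the set of terminal vertices, and the other vertices are called internal (the root may be terminal). $|v|$ is the graph distance from $v$ to $r$, and $\mathrm{R}_{\mathrm{out}}(\Lambda)=\max_{v\in V}|v|$. For $v\in V_{\mathrm{term}}(\Lambda)$ and $n\in\mathbb{N}$, the $n$-augmentation of $\Lambda$ at $v$ is the rooted tree (with the same root) obtained by attaching to $v$ a path $v=x_0,x_1,\dots,x_n$ with $x_1,\dots,x_n$ new vertices. For $l\in\mathbb{N}$, the $l$-spherical augmentation of $\Lambda$ is obtained by performing, for every $v\in V_{\mathrm{term}}(\Lambda)$, the $(\mathrm{R}_{\mathrm{out}}(\Lambda)-|v|+l)$-augmentation at $v$; $\Lambda$ is naturally a subtree of it. All terminal vertices of the $l$-spherical augmentation are at distance $\mathrm{R}_{\mathrm{out}}(\Lambda)+l$ from $r$. The outer boundary layer of $\Lambda'$ is $V_{\mathrm{out}}(\Lambda')=V_{\mathrm{term}}(\Lambda')$, and the inner boundary layer is $V_{\mathrm{in}}(\Lambda')=\{v^*\in V(\Lambda'): v^*v \text{ is an edge for some } v\in V_{\mathrm{out}}(\Lambda')\}$. Transition probabilities associated to an internal vertex $x$ of $\Lambda$ are positive numbers $t_{xy}$, indexed by the neighbors $y$ of $x$, summing to $1$. The augmented chain $X$ associated to $\Lambda'$ is the Markov chain on $V(\Lambda')$ that moves from an internal vertex $x$ of $\Lambda$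 to a neighbor $y$ with probability $t_{xy}$; that moves, from each vertex of $\Lambda'$ which is neither an internal vertex of $\Lambda$ nor a terminal vertex of $\Lambda'$ (such a vertex has exactly two neighbors in $\Lambda'$), to each of its two neighbors with probability $1/2$; and that is killed upon reaching $V_{\mathrm{out}}(\Lambda')$. The joint distribution of first hitting time and place of a set $A$ for $X$ started at $r$ is $(k,v)\mapsto \mathbb{P}^r(\tau_A=k,\ X_{\tau_A}=v)$, where $\tau_A=\inf\{n\ge 0: X_n\in A\}$ and $v\in A$. *)

theory Defs
  imports "Graph_Theory.Digraph_Component" "HOL-Probability.Probability"
begin

text \<open>
  Finite simple graphs are rendered by the locale predicate \<open>pair_graph\<close> of the entry Graph_Theory: a
  finite vertex set \<open>pverts G\<close> and a symmetric, irreflexive set \<open>parcs G\<close> of ordered pairs, so that an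
  undirected edge is a pair of opposite arcs. In such a digraph \<open>u, v, u\<close> counts as a directed cycle of
  length 2; the cycles of the undirected graph are exactly the directed cycles of length at least 3.
  (The constants \<open>forest\<close> and \<open>tree\<close> of Graph_Theory also forbid directed cycles of length 2, so they
  do not express the intended notion for symmetric digraphs.)
\<close>

definition rooted_tree :: "'a pair_pre_digraph \<Rightarrow> 'a \<Rightarrow> bool" where
  "rooted_tree G r \<longleftrightarrow> pair_graph G \<and> Digraph_Component.connected (with_proj G) \<and>
     \<not> (\<exists>p. pre_digraph.cycle (with_proj G) p \<and> 3 \<le> length p) \<and> r \<in> pverts G"

definition neighbors :: "'a pair_pre_digraph \<Rightarrow> 'a \<Rightarrow> 'a set" where
  "neighbors G v = {w. (v, w) \<in> parcs G}"

definition terminal :: "'a pair_pre_digraph \<Rightarrow> 'a set" where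
  "terminal G = {v \<in> pverts G. card (neighbors G v) = 1}"

definition internal :: "'a pair_pre_digraph \<Rightarrow> 'a set" where
  "internal G = pverts G - terminal G"

definition depth :: "'a pair_pre_digraph \<Rightarrow> 'a \<Rightarrow> 'a \<Rightarrow> nat" where
  "depth G r v = (LEAST n. (r, v) \<in> parcs G ^^ n)"

definition R_out :: "'a pair_pre_digraph \<Rightarrow> 'a \<Rightarrow> nat" where
  "R_out G r = Max (depth G r ` pverts G)"

text \<open>
  \<open>augment G n\<close> attaches to every vertex \<open>v\<close> of \<open>G\<close> a path with \<open>n v\<close> new vertices; the augmentation at
  a single vertex is the case where \<open>n\<close> vanishes at all the other vertices. The old vertex \<open>v\<close> becomes
  \<open>(v, 0)\<close>, and the new vertices \<open>x\<^sub>1, x\<^sub>2, \<dots>\<close> of the path attached to it are \<open>(v, 1), (v, 2), \<dots>\<close>.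
\<close>

definition augment :: "'a pair_pre_digraph \<Rightarrow> ('a \<Rightarrow> nat) \<Rightarrow> ('a \<times> nat) pair_pre_digraph" where
  "augment G n =
    \<lparr> pverts = {(v, i) | v i. v \<in> pverts G \<and> i \<le> n v},
      parcs = {((v, 0), (w, 0)) | v w. (v, w) \<in> parcs G}
            \<union> {((v, i), (v, Suc i)) | v i. v \<in> pverts G \<and> i < n v}
            \<union> {((v, Suc i), (v, i)) | v i. v \<in> pverts G \<and> i < n v} \<rparr>"

definition spherical_augmentation ::
    "'a pair_pre_digraph \<Rightarrow> 'a \<Rightarrow> nat \<Rightarrow> ('a \<times> nat) pair_pre_digraph" where
  "spherical_augmentation G r l =
    augment G (\<lambda>v. if v \<in> terminal G then R_out G r - depth G r v + l else 0)"

definition V_out :: "'a pair_pre_digraph \<Rightarrow> 'a set" where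
  "V_out G = terminal G"

definition V_in :: "'a pair_pre_digraph \<Rightarrow> 'a set" where
  "V_in G = {u \<in> pverts G. \<exists>v \<in> V_out G. (u, v) \<in> parcs G}"

definition transition_probabilities :: "'a pair_pre_digraph \<Rightarrow> ('a \<Rightarrow> 'a \<Rightarrow> real) \<Rightarrow> bool" where
  "transition_probabilities G t \<longleftrightarrow>
    (\<forall>x \<in> internal G. (\<forall>y \<in> neighbors G x. 0 < t x y) \<and> (\<Sum>y \<in> neighbors G x. t x y) = 1)"

text \<open>
  Killing is modelled by the cemetery state \<open>None\<close>: the chain is sent there in the step after it has
  reached \<open>V_out\<close>, so that its position at the hitting time of \<open>V_out\<close> is still defined.
\<close>

definition chain_states :: "'b pair_pre_digraph \<Rightarrow> 'b option set" where
  "chain_states H = insert None (Some ` pverts H)"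

fun augmented_transition ::
    "'a pair_pre_digraph \<Rightarrow> ('a \<times> nat) pair_pre_digraph \<Rightarrow> ('a \<Rightarrow> 'a \<Rightarrow> real) \<Rightarrow>
     ('a \<times> nat) option \<Rightarrow> ('a \<times> nat) option \<Rightarrow> real" where
  "augmented_transition G H t (Some x) (Some y) =
    (if x \<in> V_out H \<or> y \<notin> neighbors H x then 0
     else if x \<in> (\<lambda>v. (v, 0)) ` internal G then t (fst x) (fst y)
     else 1 / 2)"
| "augmented_transition G H t (Some x) None = (if x \<in> V_out H then 1 else 0)"
| "augmented_transition G H t None (Some y) = 0"
| "augmented_transition G H t None None = 1"

definition markov_chain ::
    "'w measure \<Rightarrow> 's set \<Rightarrow> ('s \<Rightarrow> 's \<Rightarrow> real) \<Rightarrow> 's \<Rightarrow> (nat \<Rightarrow> 'w \<Rightarrow> 's) \<Rightarrow> bool" where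
  "markov_chain M S p s\<^sub>0 X \<longleftrightarrow>
    prob_space M \<and>
    (\<forall>n. X n \<in> measurable M (count_space S)) \<and>
    \<P>(\<omega> in M. X 0 \<omega> = s\<^sub>0) = 1 \<and>
    (\<forall>n x. \<forall>y \<in> S. (\<forall>i\<le>n. x i \<in> S) \<and> 0 < \<P>(\<omega> in M. \<forall>i\<le>n. X i \<omega> = x i) \<longrightarrow>
       \<P>(\<omega> in M. X (Suc n) \<omega> = y \<bar> \<forall>i\<le>n. X i \<omega> = x i) = p (x n) y)"

definition augmented_chain ::
    "'a pair_pre_digraph \<Rightarrow> 'a \<Rightarrow> ('a \<times> nat) pair_pre_digraph \<Rightarrow> ('a \<Rightarrow> 'a \<Rightarrow> real) \<Rightarrow>
     'w measure \<Rightarrow> (nat \<Rightarrow> 'w \<Rightarrow> ('a \<times> nat) option) \<Rightarrow> bool" where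
  "augmented_chain G r H t M X \<longleftrightarrow>
    markov_chain M (chain_states H) (augmented_transition G H t) (Some (r, 0)) X"

definition hitting_time :: "(nat \<Rightarrow> 'w \<Rightarrow> 's) \<Rightarrow> 's set \<Rightarrow> 'w \<Rightarrow> enat" where
  "hitting_time X A \<omega> = Inf (enat ` {n. X n \<omega> \<in> A})"

definition hitting_distribution ::
    "'w measure \<Rightarrow> (nat \<Rightarrow> 'w \<Rightarrow> 'b option) \<Rightarrow> 'b set \<Rightarrow> nat \<Rightarrow> 'b \<Rightarrow> real" where
  "hitting_distribution M X A k v =
    \<P>(\<omega> in M. hitting_time X (Some ` A) \<omega> = enat k \<and> X k \<omega> = Some v)"

end

theory Submission
  imports Defs
begin

text \<open>
  The proof recovers the transition probabilities from the boundary towards the root.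

  The data are killed walks. Write \<open>a n x\<close> for the probability that the chain is at \<open>x\<close> at time \<open>n\<close>
  without having been in the outer layer before time \<open>n\<close>, and \<open>b n x\<close> for the same with the inner layer.
  The hitting distributions are the values of \<open>a\<close> at the outer layer and of \<open>b\<close> at the inner layer
  (\<open>markov_chain_killed_walk\<close>, \<open>hitting_distribution_eq_killed_walk\<close>). Both \<open>a\<close> and \<open>b\<close> satisfy the
  forward equation \<open>a (n + 1) y = (\<Sum>x. a n x * p x y)\<close>, the sum being over vertices outside the layer.

  Suppose that \<open>p\<close>, \<open>a\<close> and \<open>b\<close> are known at all vertices farther from the root than \<open>x\<close>, and let \<open>y\<close>
  be a child of \<open>x\<close>. In the forward equation at \<open>y\<close> every term is known except the one of the parent \<open>x\<close>,
  so \<open>a n x * p x y\<close> and \<open>b n x * p x y\<close> are known for all \<open>n\<close> (\<open>arrival_at_parent\<close>). This determines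
  \<open>a n x\<close>, \<open>b n x\<close> and \<open>p x y\<close> up to one common factor, and the comparison of the two layers fixes it.
  For \<open>x\<close> inside the inner layer, \<open>a n x - b n x\<close> is the probability to be at \<open>x\<close> at time \<open>n\<close> after a
  visit to the inner layer. If \<open>L\<close> is
  the distance of the inner layer from the root, the first time at which it does not vanish is
  \<open>n = 2 * L - dep x\<close>: the walk must go straight out to the inner layer and straight back to \<open>x\<close>.
  Therefore it arrives at \<open>x\<close> at that time from a child of \<open>x\<close>, and the forward equation expresses this
  positive number through known quantities (\<open>returned_first_step\<close>, \<open>returned_first\<close>). So the common factor
  is known, and with it \<open>a\<close>, \<open>b\<close> and all \<open>p x y\<close> with \<open>y\<close> a child of \<open>x\<close>; since the probabilities leaving \<open>x\<close>
  sum to 1, the probability of the step to the parent of \<open>x\<close> is known as well (\<open>agree_step\<close>).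
  The induction starts at the inner layer, which consists of vertices where the chain is symmetric.

  This uses only that every vertex except the root has a unique neighbor closer to the root, that all
  other neighbors are farther away, and that all branches end at the same distance
  (\<open>spherical_tree\<close>). For the spherical augmentation of a tree these facts come from the absence of
  cycles (\<open>no_detour\<close>, \<open>lower_neighbor_unique\<close>, \<open>spherical\<close>).
\<close>

section \<open>Hitting distributions as killed walks\<close>

text \<open>
  The probability that the walk with kernel \<open>p\<close> on \<open>V\<close>, started at \<open>s\<close>, is at \<open>y\<close> at time \<open>n\<close> and has been
  outside \<open>A\<close> at all earlier times. The point \<open>y\<close> itself may lie in \<open>A\<close>; there the value is the
  probability that \<open>A\<close> is first hit at time \<open>n\<close> and at the place \<open>y\<close>.
\<close>

primrec killed_walk :: "'v set \<Rightarrow> 'v \<Rightarrow> ('v \<Rightarrow> 'v \<Rightarrow> real) \<Rightarrow> 'v set \<Rightarrow> nat \<Rightarrow> 'v \<Rightarrow> real" where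
  "killed_walk V s p A 0 y = (if y = s then 1 else 0)"
| "killed_walk V s p A (Suc n) y = (\<Sum>x\<in>V - A. killed_walk V s p A n x * p x y)"

text \<open>
  The Markov property is given only conditionally on complete histories \<open>X 0, \<dots>, X n\<close> of positive
  probability. So the event is split into the finitely many histories that stay outside \<open>A\<close>, the last
  step is made in each of them, and the histories are collected again according to their last state.
\<close>

lemma markov_chain_killed_walk:
  fixes X :: "nat \<Rightarrow> 'w \<Rightarrow> 's"
  assumes mc: "markov_chain M S p s X" and fin: "finite S" and y: "y \<in> S"
  shows "\<P>(\<omega> in M. X n \<omega> = y \<and> (\<forall>i<n. X i \<omega> \<notin> A)) = killed_walk S s p A n y"
  using y
proof (induction n arbitrary: y)
  interpret prob_space M using mc by (simp add: markov_chain_def)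
  have meas [measurable]: "X n \<in> measurable M (count_space S)" for n
    using mc by (simp add: markov_chain_def)
  have start: "\<P>(\<omega> in M. X 0 \<omega> = s) = 1" using mc by (simp add: markov_chain_def)
  have XS: "X i \<omega> \<in> S" if "\<omega> \<in> space M" for i \<omega>
    using measurable_space[OF meas that] by simp
  have Ysets: "{\<omega>\<in>space M. X i \<omega> = z} \<in> sets M" for z i
  proof -
    have "{\<omega>\<in>space M. X i \<omega> = z} = X i -` ({z} \<inter> S) \<inter> space M" using XS by auto
    then show ?thesis using measurable_sets[OF meas, of "{z} \<inter> S" i] by simp
  qed
  {
    case (0 y)
    show ?case
    proof (cases "y = s")
      case True
      then show ?thesis using start by simp
    next
      case False
      have "AE \<omega> in M. X 0 \<omega> = s"
        using start prob_Collect_eq_1[OF Ysets] by simp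
      then have "AE \<omega> in M. \<not> X 0 \<omega> = y" using False by auto
      then have "\<P>(\<omega> in M. X 0 \<omega> = y) = 0"
        using prob_Collect_eq_0[OF Ysets] by simp
      then show ?thesis using False by simp
    qed
  next
    case (Suc n y)
    \<comment> \<open>\<open>K\<close>: the histories up to time \<open>n\<close> that stay outside \<open>A\<close>; \<open>C h\<close>: the event that \<open>h\<close> is the history.\<close>
    define C where "C h = {\<omega>\<in>space M. \<forall>i\<le>n. X i \<omega> = h i}" for h :: "nat \<Rightarrow> 's"
    define K where "K = {h \<in> {..n} \<rightarrow>\<^sub>E S. \<forall>i\<le>n. h i \<notin> A}"
    have finK: "finite K" unfolding K_def by (simp add: fin finite_PiE)
    have Csets: "C h \<in> sets M" for h
    proof -
      have "{\<omega>\<in>space M. \<forall>i\<in>{..n}. X i \<omega> = h i} \<in> sets M"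
        by (intro sets.sets_Collect_finite_All' Ysets) auto
      then show ?thesis by (simp add: C_def)
    qed
    have disj: "disjoint_family_on C K"
      unfolding disjoint_family_on_def
    proof (intro ballI impI)
      fix g h assume gh: "g \<in> K" "h \<in> K" "g \<noteq> h"
      then have "\<exists>i\<le>n. g i \<noteq> h i"
        by (auto simp: K_def PiE_iff extensional_def fun_eq_iff) (metis atMost_iff)
      then show "C g \<inter> C h = {}" by (auto simp: C_def)
    qed
    have one: "\<P>(\<omega> in M. (X (Suc n) \<omega> = y) \<and> (\<forall>i\<le>n. X i \<omega> = h i)) = measure M (C h) * p (h n) y"
      if h: "h \<in> K" for h
    proof (cases "measure M (C h) = 0")
      \<comment> \<open>A history of probability 0 contributes 0 to both sides; nothing is known about its next step.\<close>
      case True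
      have "\<P>(\<omega> in M. (X (Suc n) \<omega> = y) \<and> (\<forall>i\<le>n. X i \<omega> = h i)) \<le> measure M (C h)"
        using h by (intro finite_measure_mono) (auto simp: C_def[symmetric] Csets, auto simp: C_def)
      then show ?thesis using True by (simp add: measure_le_0_iff)
    next
      case False
      have "\<forall>i\<le>n. h i \<in> S" using h by (auto simp: K_def PiE_iff)
      moreover have "0 < \<P>(\<omega> in M. \<forall>i\<le>n. X i \<omega> = h i)"
        using False by (simp add: C_def zero_less_measure_iff)
      ultimately have "\<P>(\<omega> in M. X (Suc n) \<omega> = y \<bar> \<forall>i\<le>n. X i \<omega> = h i) = p (h n) y"
        using mc Suc.prems unfolding markov_chain_def by blast
      then show ?thesis using False unfolding cond_prob_def C_def by (simp add: field_simps)
    qed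
    have past: "\<P>(\<omega> in M. X n \<omega> = x \<and> (\<forall>i<n. X i \<omega> \<notin> A)) = (\<Sum>h\<in>{h\<in>K. h n = x}. measure M (C h))"
      if x: "x \<in> S - A" for x
    proof -
      have "{\<omega>\<in>space M. X n \<omega> = x \<and> (\<forall>i<n. X i \<omega> \<notin> A)} = (\<Union>h\<in>{h\<in>K. h n = x}. C h)"
      proof (intro equalityI subsetI)
        fix \<omega> assume w: "\<omega> \<in> {\<omega>\<in>space M. X n \<omega> = x \<and> (\<forall>i<n. X i \<omega> \<notin> A)}"
        have "restrict (\<lambda>i. X i \<omega>) {..n} \<in> {h\<in>K. h n = x}"
          using w x XS by (auto simp: K_def le_less)
        moreover have "\<omega> \<in> C (restrict (\<lambda>i. X i \<omega>) {..n})" using w by (auto simp: C_def)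
        ultimately show "\<omega> \<in> (\<Union>h\<in>{h\<in>K. h n = x}. C h)" by blast
      qed (auto simp: C_def K_def)
      also have "measure M \<dots> = (\<Sum>h\<in>{h\<in>K. h n = x}. measure M (C h))"
        using finK disj by (intro finite_measure_finite_Union) (auto simp: disjoint_family_on_def Csets)
      finally show ?thesis .
    qed
    have "{\<omega>\<in>space M. X (Suc n) \<omega> = y \<and> (\<forall>i<Suc n. X i \<omega> \<notin> A)}
        = (\<Union>h\<in>K. {\<omega>\<in>space M. X (Suc n) \<omega> = y \<and> (\<forall>i\<le>n. X i \<omega> = h i)})"
    proof (intro equalityI subsetI)
      fix \<omega> assume w: "\<omega> \<in> {\<omega>\<in>space M. X (Suc n) \<omega> = y \<and> (\<forall>i<Suc n. X i \<omega> \<notin> A)}"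
      have "restrict (\<lambda>i. X i \<omega>) {..n} \<in> K"
        using w XS by (auto simp: K_def)
      then show "\<omega> \<in> (\<Union>h\<in>K. {\<omega>\<in>space M. X (Suc n) \<omega> = y \<and> (\<forall>i\<le>n. X i \<omega> = h i)})"
        using w by (intro UN_I) auto
    qed (auto simp: K_def less_Suc_eq_le)
    also have "measure M \<dots> = (\<Sum>h\<in>K. \<P>(\<omega> in M. X (Suc n) \<omega> = y \<and> (\<forall>i\<le>n. X i \<omega> = h i)))"
    proof (rule finite_measure_finite_Union[OF finK])
      have "{\<omega>\<in>space M. X (Suc n) \<omega> = y \<and> (\<forall>i\<le>n. X i \<omega> = h i)} = {\<omega>\<in>space M. X (Suc n) \<omega> = y} \<inter> C h" for h
        by (auto simp: C_def)
      then show "(\<lambda>h. {\<omega>\<in>space M. X (Suc n) \<omega> = y \<and> (\<forall>i\<le>n. X i \<omega> = h i)}) ` K \<subseteq> sets M"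
        using Csets Ysets by auto
      show "disjoint_family_on (\<lambda>h. {\<omega>\<in>space M. X (Suc n) \<omega> = y \<and> (\<forall>i\<le>n. X i \<omega> = h i)}) K"
        using disj by (fastforce simp: disjoint_family_on_def C_def)
    qed
    also have "\<dots> = (\<Sum>h\<in>K. measure M (C h) * p (h n) y)" by (intro sum.cong refl one)
    also have "\<dots> = (\<Sum>x\<in>S - A. \<Sum>h\<in>{h\<in>K. h n = x}. measure M (C h) * p (h n) y)"
    proof (rule sum.group[symmetric, OF finK])
      show "(\<lambda>h. h n) ` K \<subseteq> S - A" by (auto simp: K_def)
    qed (simp add: fin)
    also have "\<dots> = (\<Sum>x\<in>S - A. (\<Sum>h\<in>{h\<in>K. h n = x}. measure M (C h)) * p x y)"
      by (simp add: sum_distrib_right)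
    also have "\<dots> = (\<Sum>x\<in>S - A. killed_walk S s p A n x * p x y)"
      by (intro sum.cong refl) (simp add: past[symmetric] Suc.IH)
    finally show ?case by simp
  }
qed

lemma hitting_time_eq_iff:
  assumes "X k \<omega> \<in> A"
  shows "hitting_time X A \<omega> = enat k \<longleftrightarrow> (\<forall>i<k. X i \<omega> \<notin> A)"
proof -
  have "hitting_time X A \<omega> = enat (LEAST n. X n \<omega> \<in> A)"
    unfolding hitting_time_def using assms
    by (intro cInf_eq_minimum) (auto intro: LeastI Least_le)
  moreover have "(LEAST n. X n \<omega> \<in> A) = k \<longleftrightarrow> (\<forall>i<k. X i \<omega> \<notin> A)"
    using assms by (auto dest: not_less_Least intro!: Least_equality) (meson not_less)
  ultimately show ?thesis by simp
qed

text \<open>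
  A cemetery state from which no other state can be reached does not influence the walk on the
  proper states.
\<close>

lemma killed_walk_option:
  assumes "\<And>y. q None (Some y) = 0" and "finite V"
  shows "killed_walk (insert None (Some ` V)) (Some s) q (Some ` A) n (Some y)
    = killed_walk V s (\<lambda>x y. q (Some x) (Some y)) A n y"
proof (induction n arbitrary: y)
  case (Suc n)
  have "insert None (Some ` V) - Some ` A = insert None (Some ` (V - A))" by auto
  then show ?case using assms Suc.IH by (simp add: sum.reindex)
qed simp

section \<open>Walks on a tree whose branches all end at the same distance\<close>

text \<open>
  The tree is described by its distance function \<open>dep\<close> alone, without a parent map. All branches
  end at distance \<open>Suc L\<close>, so that \<open>L\<close> is the distance of the inner layer.
\<close>

locale spherical_tree =
  fixes V :: "'v set" and E :: "('v \<times> 'v) set" and root :: 'v and dep :: "'v \<Rightarrow> nat" and L :: nat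
  assumes finite_V: "finite V"
    and arc_in_V: "(x, y) \<in> E \<Longrightarrow> x \<in> V \<and> y \<in> V"
    and arc_sym: "(x, y) \<in> E \<Longrightarrow> (y, x) \<in> E"
    and root_in_V: "root \<in> V"
    and dep_eq_0_iff: "x \<in> V \<Longrightarrow> dep x = 0 \<longleftrightarrow> x = root"
    and dep_le: "x \<in> V \<Longrightarrow> dep x \<le> Suc L"
    and arc_dep: "(x, y) \<in> E \<Longrightarrow> dep y = Suc (dep x) \<or> dep x = Suc (dep y)"
    and parent_ex: "x \<in> V \<Longrightarrow> x \<noteq> root \<Longrightarrow> \<exists>z. (z, x) \<in> E \<and> dep x = Suc (dep z)"
    and parent_unique: "(z, x) \<in> E \<Longrightarrow> (z', x) \<in> E \<Longrightarrow> dep x = Suc (dep z) \<Longrightarrow> dep x = Suc (dep z') \<Longrightarrow> z = z'"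
    and child_ex: "x \<in> V \<Longrightarrow> dep x \<le> L \<Longrightarrow> \<exists>y. (x, y) \<in> E \<and> dep y = Suc (dep x)"
begin

definition outer :: "'v set" where "outer = {x \<in> V. dep x = Suc L}"
definition inner :: "'v set" where "inner = {x \<in> V. dep x = L}"

end

text \<open>
  The kernel vanishes at the vertices of the outer layer, because the chain is killed there.
\<close>

locale spherical_walk = spherical_tree +
  fixes p :: "'a \<Rightarrow> 'a \<Rightarrow> real"
  assumes p_pos: "(x, y) \<in> E \<Longrightarrow> dep x \<le> L \<Longrightarrow> 0 < p x y"
    and p_zero: "x \<in> V \<Longrightarrow> y \<in> V \<Longrightarrow> (x, y) \<notin> E \<or> dep x = Suc L \<Longrightarrow> p x y = 0"
begin

abbreviation "walk \<equiv> killed_walk V root p"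

lemma p_nonneg: "x \<in> V \<Longrightarrow> y \<in> V \<Longrightarrow> 0 \<le> p x y"
  using p_pos[of x y] p_zero[of x y] dep_le[of x]
  by (metis le_SucE less_imp_le order_refl)

lemma walk_nonneg: "x \<in> V \<Longrightarrow> 0 \<le> walk A n x"
  by (induction n arbitrary: x) (auto intro!: sum_nonneg mult_nonneg_nonneg p_nonneg)

lemma walk_early: "x \<in> V \<Longrightarrow> n < dep x \<Longrightarrow> walk A n x = 0"
proof (induction n arbitrary: x)
  case 0
  then show ?case using dep_eq_0_iff[of x] by auto
next
  case (Suc n)
  have "walk A n z * p z x = 0" if z: "z \<in> V - A" for z
  proof (cases "(z, x) \<in> E")
    case True
    then have "n < dep z" using arc_dep[of z x] Suc.prems by auto
    then show ?thesis using Suc.IH[of z] z by simp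
  next
    case False
    then show ?thesis using p_zero[of z x] z Suc.prems by simp
  qed
  then show ?case unfolding killed_walk.simps by (intro sum.neutral) blast
qed

lemma walk_outer_on_time: "x \<in> V \<Longrightarrow> 0 < walk outer (dep x) x"
proof (induction "dep x" arbitrary: x)
  case 0
  then show ?case using dep_eq_0_iff[of x] by simp
next
  case (Suc d)
  then obtain z where z: "(z, x) \<in> E" "dep x = Suc (dep z)"
    using parent_ex[of x] dep_eq_0_iff[of x] by auto
  have zV: "z \<in> V" using arc_in_V z by blast
  have zL: "dep z \<le> L" using z dep_le[of x] Suc.prems by simp
  have "0 < walk outer (dep z) z * p z x"
    using Suc z zV zL p_pos[of z x] by simp
  have "0 < (\<Sum>u\<in>V - outer. walk outer (dep z) u * p u x)"
  proof (rule sum_pos2)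
    show "z \<in> V - outer" using zV zL by (auto simp: outer_def)
    show "0 < walk outer (dep z) z * p z x" by fact
  qed (auto simp: finite_V Suc.prems intro!: mult_nonneg_nonneg walk_nonneg p_nonneg)
  then show ?case using z by simp
qed

text \<open>
  The probability to be at \<open>x\<close> at time \<open>n\<close>, not yet killed in the outer layer, when the inner layer has been
  visited at some time up to and including \<open>n\<close>. On the inner layer itself nothing is subtracted, since
  being there is such a visit; this makes the recursion \<open>returned_Suc\<close> hold next to that layer too.
\<close>

definition returned :: "nat \<Rightarrow> 'a \<Rightarrow> real" where
  "returned n x = walk outer n x - (if dep x = L then 0 else walk inner n x)"

lemma returned_Suc:
  assumes x: "x \<in> V" "dep x < L"
  shows "returned (Suc n) x = (\<Sum>z\<in>V. returned n z * p z x)"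
proof -
  have "walk outer (Suc n) x = (\<Sum>z\<in>V. walk outer n z * p z x)"
    using finite_V x by (auto simp: outer_def p_zero intro!: sum.mono_neutral_left)
  moreover have "walk inner (Suc n) x = (\<Sum>z\<in>V. (if dep z = L then 0 else walk inner n z) * p z x)"
    unfolding killed_walk.simps
    by (rule sum.mono_neutral_cong_left) (auto simp: inner_def finite_V)
  ultimately show ?thesis
    using x by (simp add: returned_def sum_subtractf left_diff_distrib)
qed

text \<open>
  A walk from the root that visits the inner layer and then is at \<open>x\<close> has made at least
  \<open>L + (L - dep x)\<close> steps.
\<close>

lemma returned_early: "x \<in> V \<Longrightarrow> dep x \<le> L \<Longrightarrow> n + dep x < 2 * L \<Longrightarrow> returned n x = 0"
proof (induction n arbitrary: x)
  case 0
  then show ?case using dep_eq_0_iff[of x] by (auto simp: returned_def)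
next
  case (Suc n)
  show ?case
  proof (cases "dep x = L")
    case True
    then show ?thesis using Suc.prems walk_early[of x "Suc n" outer] by (simp add: returned_def)
  next
    case False
    have "returned n z * p z x = 0" if z: "z \<in> V" for z
    proof (cases "(z, x) \<in> E")
      case True
      then have "n + dep z < 2 * L" "dep z \<le> L" using arc_dep[of z x] Suc.prems False by auto
      then show ?thesis using Suc.IH[of z] z by simp
    next
      case False
      then show ?thesis using p_zero[of z x] z Suc.prems by simp
    qed
    then have "(\<Sum>z\<in>V. returned n z * p z x) = 0" by (intro sum.neutral) blast
    then show ?thesis using returned_Suc[of x n] Suc.prems False by simp
  qed
qed

text \<open>
  At the first possible time the walk is on its way straight back from the inner layer, so it cannot
  come from the parent of \<open>x\<close>. This makes the value at \<open>x\<close> a function of quantities at the children.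
\<close>

lemma returned_first_step:
  assumes x: "x \<in> V" "dep x < L" and n: "Suc n + dep x = 2 * L"
  shows "returned (Suc n) x = (\<Sum>z | (x, z) \<in> E \<and> dep z = Suc (dep x). returned n z * p z x)"
proof -
  have "returned n z * p z x = 0" if z: "z \<in> V" "\<not> ((x, z) \<in> E \<and> dep z = Suc (dep x))" for z
  proof (cases "(z, x) \<in> E")
    case True
    then have "dep x = Suc (dep z)" using arc_dep[of z x] arc_sym z by auto
    then show ?thesis using returned_early[of z n] x n z by simp
  next
    case False
    then show ?thesis using p_zero[of z x] z x by simp
  qed
  then show ?thesis
    unfolding returned_Suc[OF x] using finite_V arc_in_V
    by (intro sum.mono_neutral_right) auto
qed

lemma returned_first: "x \<in> V \<Longrightarrow> dep x \<le> L \<Longrightarrow> n + dep x = 2 * L \<Longrightarrow> 0 < returned n x"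
proof (induction n arbitrary: x)
  case 0
  then have "dep x = L" "dep x = 0" by auto
  then show ?case using walk_outer_on_time[of x] 0 unfolding returned_def by simp
next
  case (Suc n)
  show ?case
  proof (cases "dep x = L")
    case True
    then have "Suc n = L" using Suc.prems by simp
    then show ?thesis using walk_outer_on_time[of x] True Suc.prems by (simp add: returned_def)
  next
    case False
    then have x: "dep x < L" using Suc.prems by simp
    let ?C = "{z. (x, z) \<in> E \<and> dep z = Suc (dep x)}"
    have "?C \<subseteq> V" using arc_in_V by blast
    then have "finite ?C" using finite_V finite_subset by blast
    moreover have "?C \<noteq> {}" using child_ex[of x] x Suc.prems by auto
    moreover have "0 < returned n z * p z x" if z: "z \<in> ?C" for z
      using z x Suc.IH[of z] Suc.prems p_pos[of z x] arc_in_V[of x z] arc_sym[of x z] by simp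
    ultimately have "0 < (\<Sum>z\<in>?C. returned n z * p z x)" by (intro sum_pos) auto
    then show ?thesis using returned_first_step[of x n] Suc.prems x by simp
  qed
qed

lemma walk_inner_at_outer: "y \<in> outer \<Longrightarrow> walk inner n y = 0"
proof (cases n)
  case 0
  assume "y \<in> outer"
  then show ?thesis using 0 dep_eq_0_iff[of y] by (auto simp: outer_def)
next
  case (Suc m)
  assume y: "y \<in> outer"
  have "p z y = 0" if "z \<in> V - inner" for z
    using that y p_zero[of z y] arc_dep[of z y] dep_le[of z] by (auto simp: inner_def outer_def)
  then show ?thesis using Suc by simp
qed

end

section \<open>Comparing two walks with the same boundary data\<close>

locale two_walks = w: spherical_walk V E root dep L p + w': spherical_walk V E root dep L p'
  for V :: "'v set" and E root dep L p p'
begin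

text \<open>
  In the forward equation at \<open>y\<close> the parent \<open>x\<close> is the only neighbor that is not farther from the root.
  When everything farther out agrees, the terms of the parent must agree as well.
\<close>

lemma arrival_at_parent:
  assumes xy: "(x, y) \<in> E" "dep y = Suc (dep x)" and xA: "x \<notin> A"
    and y: "\<And>n. w.walk A n y = w'.walk A n y"
    and above: "\<And>z. (y, z) \<in> E \<Longrightarrow> dep z = Suc (dep y) \<Longrightarrow> p z y = p' z y \<and> (\<forall>n. w.walk A n z = w'.walk A n z)"
  shows "w.walk A n x * p x y = w'.walk A n x * p' x y"
proof -
  have V: "x \<in> V" "y \<in> V" using w.arc_in_V xy by auto
  have "w.walk A n z * p z y = w'.walk A n z * p' z y" if z: "z \<in> V - A - {x}" for z
  proof (cases "(z, y) \<in> E")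
    case True
    then have "dep z = Suc (dep y)"
      using w.arc_dep[of z y] w.parent_unique[of z y x] xy z by auto
    then show ?thesis using above[of z] True w.arc_sym by simp
  next
    case False
    then show ?thesis using w.p_zero[of z y] w'.p_zero[of z y] z V by simp
  qed
  then have "(\<Sum>z\<in>V - A - {x}. w.walk A n z * p z y) = (\<Sum>z\<in>V - A - {x}. w'.walk A n z * p' z y)"
    by (intro sum.cong) auto
  moreover have "(\<Sum>z\<in>V - A. w.walk A n z * p z y) = (\<Sum>z\<in>V - A. w'.walk A n z * p' z y)"
    using y[of "Suc n"] by simp
  ultimately show ?thesis
    using sum.remove[of "V - A" x "\<lambda>z. w.walk A n z * p z y"]
      sum.remove[of "V - A" x "\<lambda>z. w'.walk A n z * p' z y"] V xA w.finite_V by simp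
qed

definition agree :: "'v \<Rightarrow> bool" where
  "agree x \<longleftrightarrow> (\<forall>y\<in>V. p x y = p' x y) \<and>
     (\<forall>n. w.walk w.outer n x = w'.walk w.outer n x) \<and> (\<forall>n. w.walk w.inner n x = w'.walk w.inner n x)"

text \<open>
  The inductive step. The products of \<open>arrival_at_parent\<close> leave one unknown ratio between the two walks at
  \<open>x\<close>; it equals 1 because \<open>returned\<close> at its first time is positive and the same for both.
\<close>

lemma agree_step:
  assumes x: "x \<in> V" "dep x < L"
    and total: "(\<Sum>y\<in>V. p x y) = (\<Sum>y\<in>V. p' x y)"
    and above: "\<And>z. z \<in> V \<Longrightarrow> dep x < dep z \<Longrightarrow> agree z"
  shows "agree x"
proof -
  have out: "w.walk w.outer n x * p x y = w'.walk w.outer n x * p' x y"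
    if "(x, y) \<in> E" "dep y = Suc (dep x)" for n y
    using that above x w.arc_in_V
    by (intro arrival_at_parent) (auto simp: agree_def w.outer_def)
  have inn: "w.walk w.inner n x * p x y = w'.walk w.inner n x * p' x y"
    if "(x, y) \<in> E" "dep y = Suc (dep x)" for n y
    using that above x w.arc_in_V
    by (intro arrival_at_parent) (auto simp: agree_def w.inner_def)
  \<comment> \<open>\<open>Suc m\<close> is the first time at which the walk can be back at \<open>x\<close> from the inner layer.\<close>
  define m where "m = 2 * L - dep x - 1"
  have m: "Suc m + dep x = 2 * L" using x by (simp add: m_def)
  have "w.returned m z * p z x = w'.returned m z * p' z x" if "z \<in> V" "dep z = Suc (dep x)" for z
    using above[of z] that x by (auto simp: agree_def w.returned_def w'.returned_def)
  then have "w.returned (Suc m) x = w'.returned (Suc m) x"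
    using w.returned_first_step[OF x m] w'.returned_first_step[OF x m] w.arc_in_V
    by (auto intro!: sum.cong)
  moreover have pos: "0 < w.returned (Suc m) x" using w.returned_first x m by simp
  moreover have "w.returned (Suc m) x * p x y = w'.returned (Suc m) x * p' x y"
    if "(x, y) \<in> E" "dep y = Suc (dep x)" for y
    using out[OF that, of "Suc m"] inn[OF that, of "Suc m"] x
    by (simp add: w.returned_def w'.returned_def algebra_simps)
  ultimately have child: "p x y = p' x y" if "(x, y) \<in> E" "dep y = Suc (dep x)" for y
    using that by simp
  obtain y where y: "(x, y) \<in> E" "dep y = Suc (dep x)" using w.child_ex[of x] x by (meson less_imp_le)
  then have "0 < p x y" using w.p_pos x by simp
  then have walks: "w.walk w.outer n x = w'.walk w.outer n x" "w.walk w.inner n x = w'.walk w.inner n x" for n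
    using out[OF y, of n] inn[OF y, of n] child[OF y] by auto
  \<comment> \<open>The probability of the step to the parent is what the children leave of the total.\<close>
  have "p x y = p' x y" if y: "y \<in> V" for y
  proof (cases "(x, y) \<in> E \<and> dep x = Suc (dep y)")
    case True
    have "p x z = p' x z" if z: "z \<in> V - {y}" for z
    proof (cases "(x, z) \<in> E")
      case zE: True
      then have "dep z = Suc (dep x)"
        using w.arc_dep[of x z] w.parent_unique[of y x z] True z w.arc_sym by auto
      then show ?thesis using child zE by simp
    next
      case False
      then show ?thesis using w.p_zero[of x z] w'.p_zero[of x z] z x by simp
    qed
    then have "(\<Sum>z\<in>V - {y}. p x z) = (\<Sum>z\<in>V - {y}. p' x z)" by (intro sum.cong) auto
    then show ?thesis
      using total sum.remove[of V y "p x"] sum.remove[of V y "p' x"] y w.finite_V by simp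
  next
    case False
    show ?thesis
    proof (cases "(x, y) \<in> E")
      case True
      then show ?thesis using False child w.arc_dep[of x y] by auto
    next
      case False
      then show ?thesis using w.p_zero[of x y] w'.p_zero[of x y] y x by simp
    qed
  qed
  then show ?thesis using walks by (simp add: agree_def)
qed

lemma agree_on_tree:
  assumes top: "\<And>x y. x \<in> V \<Longrightarrow> dep x = L \<Longrightarrow> y \<in> V \<Longrightarrow> p x y = p' x y"
    and total: "\<And>x. x \<in> V \<Longrightarrow> dep x < L \<Longrightarrow> (\<Sum>y\<in>V. p x y) = (\<Sum>y\<in>V. p' x y)"
    and inner: "\<And>n x. x \<in> w.inner \<Longrightarrow> w.walk w.inner n x = w'.walk w.inner n x"
    and outer: "\<And>n x. x \<in> w.outer \<Longrightarrow> w.walk w.outer n x = w'.walk w.outer n x"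
    and x: "x \<in> V"
  shows "agree x"
  using x
proof (induction "Suc L - dep x" arbitrary: x rule: less_induct)
  case less
  consider "dep x = Suc L" | "dep x = L" | "dep x < L" using w.dep_le[of x] less.prems by linarith
  then show ?case
  proof cases
    case 1
    then have "x \<in> w.outer" using less.prems by (simp add: w.outer_def)
    then show ?thesis
      using 1 less.prems outer w.walk_inner_at_outer w'.walk_inner_at_outer w.p_zero w'.p_zero
      by (simp add: agree_def)
  next
    case 2
    obtain y where y: "(x, y) \<in> E" "dep y = Suc (dep x)" using w.child_ex[of x] less.prems 2 by auto
    have yV: "y \<in> V" using w.arc_in_V y by blast
    have "w.walk w.outer n x * p x y = w'.walk w.outer n x * p' x y" for n
    proof (rule arrival_at_parent[OF y])
      show "x \<notin> w.outer" using 2 by (simp add: w.outer_def)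
      show "w.walk w.outer n y = w'.walk w.outer n y" for n
        using outer yV y 2 by (simp add: w.outer_def)
      fix z assume "(y, z) \<in> E" "dep z = Suc (dep y)"
      then show "p z y = p' z y \<and> (\<forall>n. w.walk w.outer n z = w'.walk w.outer n z)"
        using w.arc_in_V[of y z] w.dep_le[of z] y 2 by simp
    qed
    moreover have "p x y = p' x y" "0 < p x y" using top[of x y] w.p_pos[of x y] less.prems yV y 2 by auto
    ultimately have "w.walk w.outer n x = w'.walk w.outer n x" for n by simp
    then show ?thesis using top inner less.prems 2 by (simp add: agree_def w.inner_def)
  next
    case 3
    have "agree z" if "z \<in> V" "dep x < dep z" for z
      using less.hyps[of z] that 3 w.dep_le[of z] by simp
    then show ?thesis using agree_step less.prems 3 total by blast
  qed
qed
end


section \<open>Distances in a finite rooted tree\<close>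

locale rooted_tree_graph =
  fixes G :: "'a pair_pre_digraph" and r :: 'a
  assumes rooted_tree: "rooted_tree G r"
begin

sublocale pair_graph G using rooted_tree by (simp add: rooted_tree_def)

lemma arc_symD: "(x, y) \<in> parcs G \<Longrightarrow> (y, x) \<in> parcs G"
  using pair_sym_arcs by (auto simp: symmetric_def sym_def)

lemma no_loop: "(x, x) \<notin> parcs G"
  using pair_no_loops[of "(x, x)"] by auto

lemma arc_verts: "(x, y) \<in> parcs G \<Longrightarrow> x \<in> pverts G \<and> y \<in> pverts G"
  using arc_fst_in_verts[of "(x, y)"] arc_snd_in_verts[of "(x, y)"] by simp

lemma root_vert: "r \<in> pverts G"
  using rooted_tree by (simp add: rooted_tree_def)

text \<open>
  A walk from \<open>u\<close> to \<open>w\<close> around the edge between them can be shortened to a simple path. It has at least two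
  arcs, so the edge closes it to a cycle of length at least 3.
\<close>

lemma no_detour:
  assumes e: "(u, w) \<in> parcs G"
  shows "(u, w) \<notin> (parcs G - {(u, w), (w, u)})\<^sup>*"
proof
  assume *: "(u, w) \<in> (parcs G - {(u, w), (w, u)})\<^sup>*"
  define G' where "G' = \<lparr> pverts = pverts G, parcs = parcs G - {(u, w), (w, u)} \<rparr>"
  interpret G': pair_wf_digraph G'
    by unfold_locales (auto simp: G'_def arc_verts)
  have uw: "u \<in> pverts G" "w \<in> pverts G" "u \<noteq> w" using arc_verts[OF e] no_loop e by auto
  have "u \<rightarrow>\<^sup>*\<^bsub>with_proj G'\<^esub> w"
    using * uw by (simp add: G'.reachable_conv) (simp add: G'_def)
  then obtain p where p: "G'.apath u p w" by (auto simp: G'.reachable_apath)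
  then have cas: "pcas u p w" and dist: "distinct (pawalk_verts u p)" and arcs: "set p \<subseteq> parcs G - {(u, w), (w, u)}"
    unfolding G'.apath_def G'.awalk_def by (simp_all add: G'_def)
  have "p \<noteq> []" using cas uw by auto
  moreover have "p \<noteq> [a]" for a using cas arcs by (cases a) auto
  ultimately have len: "2 \<le> length p" by (cases p; cases "tl p") auto
  have pw: "awalk u p w" using cas arcs uw by (auto simp: awalk_def)
  moreover have "awalk w [(w, u)] u" using arc_symD[OF e] uw by (auto simp: awalk_def)
  ultimately have "awalk u (p @ [(w, u)]) u" by (rule awalk_appendI)
  moreover have "distinct (tl (pawalk_verts u (p @ [(w, u)])))"
  proof -
    have "pawalk_verts u (p @ [(w, u)]) = pawalk_verts u p @ [u]"
      using awalk_verts_append[OF \<open>awalk u (p @ [(w, u)]) u\<close>] awlast_of_awalk[OF pw] by simp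
    then show ?thesis using dist cas by (cases p) auto
  qed
  ultimately have "cycle (p @ [(w, u)])" by (auto simp: cycle_def)
  moreover have "3 \<le> length (p @ [(w, u)])" using len by simp
  ultimately show False using rooted_tree unfolding rooted_tree_def by blast
qed

abbreviation d :: "'a \<Rightarrow> nat" where "d \<equiv> depth G r"

lemma depth_relpow:
  assumes v: "v \<in> pverts G"
  shows "(r, v) \<in> parcs G ^^ d v"
proof -
  have "strongly_connected (with_proj G)"
  proof (rule symmetric_connected_imp_strongly_connected)
    show "symmetric (with_proj G)" by (rule pair_sym_arcs)
    show "connected (with_proj G)" using rooted_tree unfolding rooted_tree_def by (elim conjE)
  qed
  then have "r \<rightarrow>\<^sup>*\<^bsub>with_proj G\<^esub> v"
    using v root_vert by (simp add: strongly_connected_def)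
  then have "(r, v) \<in> (parcs G)\<^sup>*" using reachable_rtranclI[of "with_proj G" r v] by simp
  then obtain n where "(r, v) \<in> parcs G ^^ n" using rtrancl_imp_relpow by blast
  then show ?thesis unfolding depth_def by (rule LeastI)
qed

lemma depth_le: "(r, v) \<in> parcs G ^^ n \<Longrightarrow> d v \<le> n"
  unfolding depth_def by (rule Least_le)

lemma depth_root: "d r = 0"
  using depth_le[of r 0] by simp

lemma depth_eq_0: "v \<in> pverts G \<Longrightarrow> d v = 0 \<longleftrightarrow> v = r"
  using depth_relpow[of v] depth_root by auto

lemma depth_arc:
  assumes "(u, v) \<in> parcs G"
  shows "d v \<le> Suc (d u)"
proof (rule depth_le)
  show "(r, v) \<in> parcs G ^^ Suc (d u)"
    using relpow_Suc_I[OF depth_relpow assms] arc_verts[OF assms] by blast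
qed

lemma depth_pred:
  assumes "v \<in> pverts G" "v \<noteq> r"
  shows "\<exists>z. (z, v) \<in> parcs G \<and> d v = Suc (d z)"
proof -
  obtain n where n: "d v = Suc n" using assms depth_eq_0[of v] by (cases "d v") auto
  then obtain z where z: "(r, z) \<in> parcs G ^^ n" "(z, v) \<in> parcs G"
    using depth_relpow[of v] assms by auto
  then show ?thesis using depth_le[of z n] depth_arc[of z v] n by (intro exI[of _ z]) auto
qed

text \<open>
  Equality \<open>d u = d w\<close> is admitted, so that the lemma excludes a second parent of \<open>w\<close> and also an edge
  between vertices at the same distance. Say \<open>d u' \<le> d u\<close>. All vertices except \<open>w\<close> that are at most as far
  away as \<open>u\<close> are reached from the root without passing through \<open>w\<close>, so \<open>u\<close> is joined with \<open>u'\<close>, and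
  then with \<open>w\<close>, by a walk that avoids the edge between \<open>u\<close> and \<open>w\<close>.
\<close>

lemma lower_neighbor_unique:
  assumes u: "(u, w) \<in> parcs G" "d u \<le> d w" and u': "(u', w) \<in> parcs G" "d u' \<le> d w"
  shows "u = u'"
proof -
  have *: False
    if u: "(u, w) \<in> parcs G" "d u \<le> d w" and u': "(u', w) \<in> parcs G" "d u' \<le> d u" and ne: "u \<noteq> u'" for u u'
  proof -
    let ?E = "parcs G - {(u, w), (w, u)}"
    have reach: "x \<in> pverts G \<Longrightarrow> d x \<le> d u \<Longrightarrow> x \<noteq> w \<Longrightarrow> (r, x) \<in> ?E\<^sup>*" for x
    proof (induction "d x" arbitrary: x)
      case 0
      then have "x = r" using depth_eq_0[of x] by metis
      then show ?case by simp
    next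
      case (Suc n)
      have "x \<noteq> r" using depth_root Suc.hyps(2) by (metis Zero_not_Suc)
      then obtain z where z: "(z, x) \<in> parcs G" "d x = Suc (d z)"
        using depth_pred Suc.prems(1) by blast
      have zw: "z \<noteq> w" using z(2) Suc.prems(2) u(2) by auto
      have "(r, z) \<in> ?E\<^sup>*"
        using Suc.hyps(1)[of z] Suc.hyps(2) z arc_verts[OF z(1)] zw Suc.prems(2) by linarith
      moreover have "(z, x) \<in> ?E" using z(1) zw Suc.prems(3) by auto
      ultimately show ?case by (rule rtrancl_into_rtrancl)
    qed
    have "sym ?E" using arc_symD by (auto simp: sym_def)
    then have "sym (?E\<^sup>*)" by (rule sym_rtrancl)
    moreover have "(r, u) \<in> ?E\<^sup>*" using reach[of u] u arc_verts[OF u(1)] no_loop[of w] by auto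
    ultimately have "(u, r) \<in> ?E\<^sup>*" by (auto dest: symD)
    moreover have "(r, u') \<in> ?E\<^sup>*" using reach[of u'] u' arc_verts[OF u'(1)] no_loop[of w] by auto
    ultimately have "(u, u') \<in> ?E\<^sup>*" by (rule rtrancl_trans)
    moreover have "(u', w) \<in> ?E" using u' ne no_loop[of w] by auto
    ultimately have "(u, w) \<in> ?E\<^sup>*" by (rule rtrancl_into_rtrancl)
    then show False using no_detour[OF u(1)] by blast
  qed
  show ?thesis
  proof (cases "d u' \<le> d u")
    case True
    then show ?thesis using *[of u u'] assms by blast
  next
    case False
    then show ?thesis using *[of u' u] u u' by auto
  qed
qed

lemma depth_arc_cases:
  assumes "(x, y) \<in> parcs G"
  shows "d y = Suc (d x) \<or> d x = Suc (d y)"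
proof -
  have "d x \<noteq> d y"
  proof
    assume eq: "d x = d y"
    show False
    proof (cases "y = r")
      case True
      then have "x = r" using eq depth_root depth_eq_0[of x] arc_verts assms by auto
      then show False using True no_loop assms by simp
    next
      case False
      then obtain z where "(z, y) \<in> parcs G" "d y = Suc (d z)"
        using depth_pred arc_verts assms by blast
      then show False using lower_neighbor_unique[of x y z] eq assms by auto
    qed
  qed
  then show ?thesis using depth_arc[OF assms] depth_arc[OF arc_symD[OF assms]] by linarith
qed

lemma depth_le_R_out: "v \<in> pverts G \<Longrightarrow> d v \<le> R_out G r"
  unfolding R_out_def by (simp add: pair_finite_verts)

lemma neighbors_terminal: "v \<in> terminal G \<Longrightarrow> \<exists>w. neighbors G v = {w}"
  by (auto simp: terminal_def card_1_singleton_iff)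

lemma internal_child:
  assumes v: "v \<in> internal G" and ne: "neighbors G v \<noteq> {}"
  shows "\<exists>w. (v, w) \<in> parcs G \<and> d w = Suc (d v)"
proof (cases "v = r")
  case True
  obtain w where w: "(v, w) \<in> parcs G" using ne by (auto simp: neighbors_def)
  then show ?thesis using depth_arc_cases[OF w] True depth_root by auto
next
  case False
  then obtain z where z: "(z, v) \<in> parcs G" "d v = Suc (d z)"
    using depth_pred v by (auto simp: internal_def)
  have "neighbors G v \<noteq> {z}" using v by (auto simp: internal_def terminal_def)
  then obtain w where w: "(v, w) \<in> parcs G" "w \<noteq> z" using ne by (auto simp: neighbors_def)
  then show ?thesis
    using depth_arc_cases[OF w(1)] lower_neighbor_unique[OF arc_symD[OF w(1)] _ z(1)] z by auto
qed

end

section \<open>The spherical augmentation\<close>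

text \<open>
  The second assumption excludes the tree with a single vertex, which is internal and has no neighbor
  to which transition probabilities could be assigned.
\<close>

locale augmented_tree = rooted_tree_graph +
  fixes H :: "('a \<times> nat) pair_pre_digraph"
  assumes H: "H = spherical_augmentation G r 2"
    and internal_neighbors: "v \<in> internal G \<Longrightarrow> neighbors G v \<noteq> {}"
begin

definition len :: "'a \<Rightarrow> nat" where
  "len v = (if v \<in> terminal G then R_out G r - d v + 2 else 0)"

lemma pverts_H: "pverts H = {(v, i) | v i. v \<in> pverts G \<and> i \<le> len v}"
  by (simp add: H spherical_augmentation_def augment_def len_def)

lemma parcs_H: "parcs H = {((v, 0), (w, 0)) | v w. (v, w) \<in> parcs G}
            \<union> {((v, i), (v, Suc i)) | v i. v \<in> pverts G \<and> i < len v}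
            \<union> {((v, Suc i), (v, i)) | v i. v \<in> pverts G \<and> i < len v}"
  by (simp add: H spherical_augmentation_def augment_def len_def)

abbreviation dep :: "'a \<times> nat \<Rightarrow> nat" where "dep x \<equiv> d (fst x) + snd x"

lemma len_internal: "v \<in> internal G \<Longrightarrow> len v = 0"
  by (simp add: len_def internal_def)

text \<open>
  A vertex \<open>(v, i)\<close> of the path attached to \<open>v\<close> is at distance \<open>d v + i\<close>. The paths have been chosen to end at
  distance \<open>R_out G r + 2\<close>; an internal vertex has a child since it has a neighbor besides its parent.
\<close>

lemma spherical: "spherical_tree (pverts H) (parcs H) (r, 0) dep (Suc (R_out G r))"
proof
  have "pverts H = (SIGMA v:pverts G. {..len v})" by (auto simp: pverts_H)
  then show "finite (pverts H)" by (simp add: pair_finite_verts)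
next
  fix x y assume xy: "(x, y) \<in> parcs H"
  show "x \<in> pverts H \<and> y \<in> pverts H" using xy by (auto simp: parcs_H pverts_H arc_verts)
  show "(y, x) \<in> parcs H" using xy by (auto simp: parcs_H arc_symD)
  show "dep y = Suc (dep x) \<or> dep x = Suc (dep y)" using xy by (auto simp: parcs_H dest: depth_arc_cases)
next
  show "(r, 0) \<in> pverts H" by (simp add: pverts_H root_vert)
next
  fix x assume x: "x \<in> pverts H"
  then obtain v i where vi: "x = (v, i)" "v \<in> pverts G" "i \<le> len v" by (auto simp: pverts_H)
  show "dep x = 0 \<longleftrightarrow> x = (r, 0)" using vi depth_eq_0[of v] by auto
  show "dep x \<le> Suc (Suc (R_out G r))"
    using vi depth_le_R_out[of v] by (auto simp: len_def split: if_splits)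
  show "\<exists>z. (z, x) \<in> parcs H \<and> dep x = Suc (dep z)" if nr: "x \<noteq> (r, 0)"
  proof (cases i)
    case 0
    then obtain z where "(z, v) \<in> parcs G" "d v = Suc (d z)" using depth_pred[of v] nr vi by auto
    then show ?thesis using vi 0 by (intro exI[of _ "(z, 0)"]) (auto simp: parcs_H)
  next
    case (Suc j)
    then show ?thesis using vi by (intro exI[of _ "(v, j)"]) (auto simp: parcs_H)
  qed
  show "\<exists>y. (x, y) \<in> parcs H \<and> dep y = Suc (dep x)" if le: "dep x \<le> Suc (R_out G r)"
  proof (cases "v \<in> internal G")
    case True
    then obtain w where "(v, w) \<in> parcs G" "d w = Suc (d v)" using internal_child internal_neighbors by blast
    then show ?thesis using vi len_internal[OF True] by (intro exI[of _ "(w, 0)"]) (auto simp: parcs_H)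
  next
    case False
    then have "i < len v" using vi le depth_le_R_out[of v] by (auto simp: len_def internal_def)
    then show ?thesis using vi by (intro exI[of _ "(v, Suc i)"]) (auto simp: parcs_H)
  qed
next
  fix z x z' assume "(z, x) \<in> parcs H" "(z', x) \<in> parcs H" "dep x = Suc (dep z)" "dep x = Suc (dep z')"
  then show "z = z'"
    by (auto simp: parcs_H intro: lower_neighbor_unique)
qed

sublocale S: spherical_tree "pverts H" "parcs H" "(r, 0)" dep "Suc (R_out G r)"
  by (rule spherical)

lemma neighbors_internal: "v \<in> internal G \<Longrightarrow> neighbors H (v, 0) = (\<lambda>w. (w, 0)) ` neighbors G v"
  using len_internal[of v] by (auto simp: neighbors_def parcs_H)

text \<open>
  The root has no parent, so one child would make it terminal. If it is terminal in \<open>G\<close>, the path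
  attached to it supplies a second neighbor.
\<close>

lemma card_neighbors_root: "card (neighbors H (r, 0)) \<noteq> 1"
proof (cases "r \<in> internal G")
  case True
  then have "card (neighbors H (r, 0)) = card (neighbors G r)"
    by (simp add: neighbors_internal card_image inj_on_def)
  then show ?thesis using True root_vert by (auto simp: internal_def terminal_def)
next
  case False
  then have "r \<in> terminal G" using root_vert by (simp add: internal_def)
  then obtain w where "(r, w) \<in> parcs G" using neighbors_terminal by (fastforce simp: neighbors_def)
  then have "(w, 0) \<in> neighbors H (r, 0)" "(r, Suc 0) \<in> neighbors H (r, 0)"
    using \<open>r \<in> terminal G\<close> root_vert by (auto simp: neighbors_def parcs_H len_def)
  then show ?thesis by (auto simp: card_1_singleton_iff)
qed

lemma V_out_H: "V_out H = S.outer"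
proof -
  have "card (neighbors H x) = 1 \<longleftrightarrow> dep x = Suc (Suc (R_out G r))" if x: "x \<in> pverts H" for x
  proof (cases "x = (r, 0)")
    case True
    then show ?thesis using card_neighbors_root depth_root by auto
  next
    case False
    then obtain z where z: "(z, x) \<in> parcs H" "dep x = Suc (dep z)" using S.parent_ex x by blast
    show ?thesis
    proof
      assume "card (neighbors H x) = 1"
      moreover have "z \<in> neighbors H x" using S.arc_sym z by (simp add: neighbors_def)
      ultimately have nb: "neighbors H x = {z}" by (auto simp: card_1_singleton_iff)
      show "dep x = Suc (Suc (R_out G r))"
      proof (rule ccontr)
        assume "dep x \<noteq> Suc (Suc (R_out G r))"
        then have "dep x \<le> Suc (R_out G r)" using S.dep_le[OF x] by simp
        then obtain y where y: "(x, y) \<in> parcs H" "dep y = Suc (dep x)" using S.child_ex[OF x] by blast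
        then have "y \<in> neighbors H x" by (simp add: neighbors_def)
        then show False using nb z y by simp
      qed
    next
      assume top: "dep x = Suc (Suc (R_out G r))"
      have "w = z" if "(x, w) \<in> parcs H" for w
        using S.arc_dep[OF that] S.dep_le[of w] S.arc_in_V[OF that] top
          S.parent_unique[OF S.arc_sym[OF that] z(1)] z by auto
      moreover have "(x, z) \<in> parcs H" using S.arc_sym[OF z(1)] .
      ultimately have "neighbors H x = {z}" unfolding neighbors_def by blast
      then show "card (neighbors H x) = 1" by simp
    qed
  qed
  then show ?thesis by (auto simp: V_out_def terminal_def S.outer_def)
qed

lemma V_in_H: "V_in H = S.inner"
proof -
  have "(\<exists>v\<in>V_out H. (u, v) \<in> parcs H) \<longleftrightarrow> dep u = Suc (R_out G r)" if u: "u \<in> pverts H" for u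
  proof
    assume "\<exists>v\<in>V_out H. (u, v) \<in> parcs H"
    then show "dep u = Suc (R_out G r)"
      using S.arc_dep S.dep_le[OF u] unfolding V_out_H S.outer_def by fastforce
  next
    assume du: "dep u = Suc (R_out G r)"
    then obtain y where y: "(u, y) \<in> parcs H" "dep y = Suc (dep u)" using S.child_ex[OF u] by auto
    then have "y \<in> V_out H" using S.arc_in_V[OF y(1)] du by (simp add: V_out_H S.outer_def)
    then show "\<exists>v\<in>V_out H. (u, v) \<in> parcs H" using y by blast
  qed
  then show ?thesis by (auto simp: V_in_def S.inner_def)
qed

abbreviation kernel :: "('a \<Rightarrow> 'a \<Rightarrow> real) \<Rightarrow> 'a \<times> nat \<Rightarrow> 'a \<times> nat \<Rightarrow> real" where
  "kernel t x y \<equiv> augmented_transition G H t (Some x) (Some y)"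

lemma internal_not_outer: "v \<in> internal G \<Longrightarrow> (v, 0) \<notin> V_out H"
  using depth_le_R_out[of v] by (auto simp: V_out_H S.outer_def internal_def)

lemma kernel_walk:
  assumes "transition_probabilities G t"
  shows "spherical_walk (pverts H) (parcs H) (r, 0) dep (Suc (R_out G r)) (kernel t)"
proof
  fix x y assume xy: "(x, y) \<in> parcs H" "dep x \<le> Suc (R_out G r)"
  have "0 < t (fst x) (fst y)" if int: "x \<in> (\<lambda>v. (v, 0)) ` internal G"
  proof -
    obtain v where v: "x = (v, 0)" "v \<in> internal G" using int by blast
    have "y \<in> neighbors H (v, 0)" using xy v by (simp add: neighbors_def)
    then have "y \<in> (\<lambda>w. (w, 0)) ` neighbors G v" by (simp only: neighbors_internal[OF v(2)])
    then show ?thesis using v assms by (auto simp: transition_probabilities_def)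
  qed
  then show "0 < kernel t x y" using xy by (auto simp: neighbors_def V_out_H S.outer_def)
qed (auto simp: neighbors_def V_out_H S.outer_def)

lemma kernel_total:
  assumes t: "transition_probabilities G t" and v: "v \<in> internal G"
  shows "(\<Sum>y\<in>pverts H. kernel t (v, 0) y) = 1"
proof -
  have "(\<Sum>y\<in>pverts H. kernel t (v, 0) y) = (\<Sum>y\<in>neighbors H (v, 0). t v (fst y))"
  proof (rule sum.mono_neutral_cong_right[OF S.finite_V])
    show "neighbors H (v, 0) \<subseteq> pverts H" unfolding neighbors_def using S.arc_in_V by blast
  qed (use v internal_not_outer[OF v] in auto)
  also have "\<dots> = (\<Sum>y\<in>(\<lambda>w. (w, 0::nat)) ` neighbors G v. t v (fst y))"
    by (simp add: neighbors_internal[OF v])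
  also have "\<dots> = (\<Sum>w\<in>neighbors G v. t v w)"
    by (simp add: sum.reindex inj_on_def)
  finally show ?thesis using t v by (simp add: transition_probabilities_def)
qed


lemma hitting_distribution_eq_killed_walk:
  assumes chain: "augmented_chain G r H t M X" and v: "v \<in> A" and A: "A \<subseteq> pverts H"
  shows "hitting_distribution M X A k v = killed_walk (pverts H) (r, 0) (kernel t) A k v"
proof -
  have "hitting_distribution M X A k v = \<P>(\<omega> in M. X k \<omega> = Some v \<and> (\<forall>i<k. X i \<omega> \<notin> Some ` A))"
  proof -
    have "hitting_time X (Some ` A) \<omega> = enat k \<and> X k \<omega> = Some v
        \<longleftrightarrow> X k \<omega> = Some v \<and> (\<forall>i<k. X i \<omega> \<notin> Some ` A)" for \<omega>
      using hitting_time_eq_iff[of X k \<omega> "Some ` A"] v by auto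
    then show ?thesis by (simp add: hitting_distribution_def)
  qed
  also have "\<dots> = killed_walk (chain_states H) (Some (r, 0)) (augmented_transition G H t) (Some ` A) k (Some v)"
    using chain v A S.finite_V unfolding augmented_chain_def
    by (intro markov_chain_killed_walk) (auto simp: chain_states_def)
  also have "\<dots> = killed_walk (pverts H) (r, 0) (kernel t) A k v"
    unfolding chain_states_def by (rule killed_walk_option) (simp_all add: S.finite_V)
  finally show ?thesis .
qed

lemma kernel_determined:
  assumes t: "transition_probabilities G t" and t': "transition_probabilities G t'"
    and X: "augmented_chain G r H t M X" and X': "augmented_chain G r H t' M' X'"
    and inner: "\<And>k v. v \<in> V_in H \<Longrightarrow>
      hitting_distribution M X (V_in H) k v = hitting_distribution M' X' (V_in H) k v"
    and outer: "\<And>k v. v \<in> V_out H \<Longrightarrow>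
      hitting_distribution M X (V_out H) k v = hitting_distribution M' X' (V_out H) k v"
    and x: "x \<in> pverts H" and y: "y \<in> pverts H"
  shows "kernel t x y = kernel t' x y"
proof -
  interpret W: two_walks "pverts H" "parcs H" "(r, 0)" dep "Suc (R_out G r)" "kernel t" "kernel t'"
    using kernel_walk[OF t] kernel_walk[OF t'] by (simp add: two_walks_def)
  have in_out: "V_in H \<subseteq> pverts H" "V_out H \<subseteq> pverts H"
    by (auto simp: V_in_def V_out_def terminal_def)
  have "W.agree x"
  proof (rule W.agree_on_tree[OF _ _ _ _ x])
    \<comment> \<open>The inner layer is at distance \<open>R_out G r + 1\<close>, beyond all vertices of \<open>G\<close>.\<close>
    fix u z assume u: "u \<in> pverts H" "dep u = Suc (R_out G r)"
    have "u \<notin> (\<lambda>v. (v, 0)) ` internal G"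
    proof
      assume "u \<in> (\<lambda>v. (v, 0)) ` internal G"
      then obtain v where "u = (v, 0)" "v \<in> pverts G" by (auto simp: internal_def)
      then show False using depth_le_R_out[of v] u by simp
    qed
    then show "kernel t u z = kernel t' u z" by simp
  next
    fix u assume "u \<in> pverts H" "dep u < Suc (R_out G r)"
    show "(\<Sum>z\<in>pverts H. kernel t u z) = (\<Sum>z\<in>pverts H. kernel t' u z)"
    proof (cases "u \<in> (\<lambda>v. (v, 0)) ` internal G")
      case True
      then show ?thesis using kernel_total t t' by auto
    next
      case False
      then show ?thesis by (intro sum.cong) simp_all
    qed
  next
    fix n u assume "u \<in> S.inner"
    then show "W.w.walk S.inner n u = W.w'.walk S.inner n u"
      using inner[of u n] hitting_distribution_eq_killed_walk[OF X _ in_out(1)]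
        hitting_distribution_eq_killed_walk[OF X' _ in_out(1)] by (simp add: V_in_H)
  next
    fix n u assume "u \<in> S.outer"
    then show "W.w.walk S.outer n u = W.w'.walk S.outer n u"
      using outer[of u n] hitting_distribution_eq_killed_walk[OF X _ in_out(2)]
        hitting_distribution_eq_killed_walk[OF X' _ in_out(2)] by (simp add: V_out_H)
  qed
  then have "\<forall>y\<in>pverts H. kernel t x y = kernel t' x y" unfolding W.agree_def by (rule conjunct1)
  then show ?thesis using y by (rule bspec)
qed

end

theorem theorem1p1:
  fixes G :: "'a pair_pre_digraph" and r :: 'a and t t' :: "'a \<Rightarrow> 'a \<Rightarrow> real"
    and M :: "'w measure" and M' :: "'u measure"
    and X :: "nat \<Rightarrow> 'w \<Rightarrow> ('a \<times> nat) option" and X' :: "nat \<Rightarrow> 'u \<Rightarrow> ('a \<times> nat) option"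
    and H :: "('a \<times> nat) pair_pre_digraph"
  assumes "rooted_tree G r"
    and "H = spherical_augmentation G r 2"
    and "transition_probabilities G t"
    and "transition_probabilities G t'"
    and "augmented_chain G r H t M X"
    and "augmented_chain G r H t' M' X'"
    and "\<forall>k. \<forall>v \<in> V_in H. hitting_distribution M X (V_in H) k v = hitting_distribution M' X' (V_in H) k v"
    and "\<forall>k. \<forall>v \<in> V_out H. hitting_distribution M X (V_out H) k v = hitting_distribution M' X' (V_out H) k v"
  shows "\<forall>x \<in> chain_states H. \<forall>y \<in> chain_states H.
    augmented_transition G H t x y = augmented_transition G H t' x y"
proof -
  interpret augmented_tree G r H
  proof
    fix v assume "v \<in> internal G"
    \<comment> \<open>An empty sum would be 0.\<close>
    then have "(\<Sum>y \<in> neighbors G v. t v y) = 1"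
      using assms(3) by (simp add: transition_probabilities_def)
    then show "neighbors G v \<noteq> {}" by auto
  qed (fact assms(1,2))+
  have "kernel t x y = kernel t' x y" if "x \<in> pverts H" "y \<in> pverts H" for x y
    by (rule kernel_determined[OF assms(3-6) _ _ that]) (use assms(7,8) in auto)
  then show ?thesis
    unfolding chain_states_def by auto
qed

end
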